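(* Let $A$ be an $n\times n$ entrywise nonnegative real matrix with positive diagonal entries, and let $\mathbf{x}\in\mathbb{R}^n$ be a vector with all entries positive. For integers $q\ge0$, define $$C_q:=\max_{1\le i\le n}\frac{(A^{q+1}\mathbf{x})_i}{(A^q\mathbf{x})_i}.$$ Then the sequence $(C_q)_{q\ge0}$ is non-increasing, and $$\rho(A)=\lim_{q\to\infty}C_q=\inf_{q\ge0}C_q,$$ where $\rho(A)$ is the spectral radius of $A$. *)

theory Defs
  imports "Jordan_Normal_Form.Spectral_Radius"
begin

definition max_ratio :: "real mat \<Rightarrow> real vec \<Rightarrow> nat \<Rightarrow> real" where
  "max_ratio A x q =
     Max ((\<lambda>i. ((A ^\<^sub>m (q + 1)) *\<^sub>v x) $ i / ((A ^\<^sub>m q) *\<^sub>v x) $ i) ` {..<dim_row A})"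

text \<open>The library's spectral radius takes a complex matrix: the eigenvalues of a real matrix
  that enter its spectral radius are the complex ones.\<close>

definition real_spectral_radius :: "real mat \<Rightarrow> real" where
  "real_spectral_radius A = spectral_radius (map_mat complex_of_real A)"

end

theory Submission
  imports Defs
begin

text \<open>
  Write \<open>u q\<close> for the vector \<open>A\<^sup>q x\<close>, \<open>r i q\<close> for the ratio of the \<open>i\<close>-th coordinates of
  \<open>u (Suc q)\<close> and \<open>u q\<close>, and \<open>C q\<close> for the largest of these ratios; let \<open>\<rho>\<close> be the spectral
  radius.

  An inequality \<open>A y \<le> c y\<close> with \<open>y > 0\<close> is preserved by applying \<open>A\<close>, so \<open>C\<close> is non-increasing,
  and it forces \<open>\<rho> \<le> c\<close> (lemma \<open>Collatz_Wielandt_upper_bound\<close>). What remains is that the limit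
  \<open>c\<close> of \<open>C\<close> does not exceed \<open>\<rho>\<close>. The matrix may be reducible, so there need not be a positive
  eigenvector to compare with; two facts about single coordinates replace it.

  The first is that each coordinate alone obeys the spectral growth bound: for every \<open>s > \<rho>\<close> there
  is a constant \<open>L\<close> with \<open>u (m + q) $ i \<le> L * s ^ m * u q $ i\<close> for all \<open>i\<close>, \<open>m\<close>, \<open>q\<close> (lemma
  \<open>uniform_growth\<close>). Indeed \<open>u (m + q) $ i\<close> only involves coordinates \<open>j\<close> with
  \<open>(A\<^sup>m)\<^sub>i\<^sub>j > 0\<close>, and such a coordinate can never be much larger than the \<open>i\<close>-th one, because a fixed
  number of steps later it would make the latter grow faster than \<open>C 0\<close> permits.

  The second is that a ratio cannot jump up: since \<open>r i (Suc q)\<close> is an average of all the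
  ratios at time \<open>q\<close> in which, by the positive diagonal, \<open>r i q\<close> has weight bounded below, a ratio close to the maximum must
  have been close to it one step before. Once \<open>C\<close> has almost reached its limit \<open>c\<close>, the coordinate
  that realises the maximum therefore has had ratios close to \<open>c\<close> throughout a time window of
  any prescribed length \<open>m\<close> (lemma \<open>large_ratio_window\<close>), and has grown by almost \<open>c ^ m\<close>
  over it. If \<open>c > \<rho>\<close>, this contradicts the first bound for large \<open>m\<close>.
\<close>

section \<open>Spectral bounds\<close>

lemma spectral_radius_nonneg:
  assumes "B \<in> carrier_mat n n" "n > 0"
  shows "spectral_radius B \<ge> 0"
  using spectral_radius_mem_max(1)[OF assms] by auto

lemma mult_mat_vec_sum:
  assumes "A \<in> carrier_mat n n" "v \<in> carrier_vec n" "i < n"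
  shows "(A *\<^sub>v v) $ i = (\<Sum>j<n. A $$ (i, j) * v $ j)"
  using assms by (auto simp: scalar_prod_def lessThan_atLeast0 intro!: sum.cong)

lemma pow_smult_mat:
  fixes B :: "'a :: comm_ring_1 mat"
  assumes B: "B \<in> carrier_mat n n"
  shows "(c \<cdot>\<^sub>m B) ^\<^sub>m k = c ^ k \<cdot>\<^sub>m (B ^\<^sub>m k)"
proof (induction k)
  case 0
  then show ?case using B by auto
next
  case (Suc k)
  have Bk: "B ^\<^sub>m k \<in> carrier_mat n n" using B by simp
  have "(c \<cdot>\<^sub>m B) ^\<^sub>m Suc k = (c ^ k \<cdot>\<^sub>m (B ^\<^sub>m k)) * (c \<cdot>\<^sub>m B)"
    by (simp add: Suc)
  also have "\<dots> = c ^ k \<cdot>\<^sub>m ((B ^\<^sub>m k) * (c \<cdot>\<^sub>m B))"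
    using Bk B by (intro mult_smult_assoc_mat) auto
  also have "(B ^\<^sub>m k) * (c \<cdot>\<^sub>m B) = c \<cdot>\<^sub>m (B ^\<^sub>m k * B)"
    using Bk B by (intro mult_smult_distrib) auto
  also have "c ^ k \<cdot>\<^sub>m (c \<cdot>\<^sub>m (B ^\<^sub>m k * B)) = c ^ Suc k \<cdot>\<^sub>m (B ^\<^sub>m Suc k)"
    by (rule eq_matI) (auto simp: ac_simps)
  finally show ?case .
qed

text \<open>After division by \<open>s\<close> the spectral radius is less than one, so the powers stay
  bounded by the Jordan normal form.\<close>

lemma power_entries_bound:
  fixes B :: "complex mat"
  assumes B: "B \<in> carrier_mat n n" and n: "n > 0" and s: "spectral_radius B < s"
  obtains K where "\<And>k i j. i < n \<Longrightarrow> j < n \<Longrightarrow> norm ((B ^\<^sub>m k) $$ (i, j)) \<le> K * s ^ k"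
proof -
  have s0: "s > 0" using spectral_radius_nonneg[OF B n] s by simp
  define D where "D = complex_of_real (1 / s) \<cdot>\<^sub>m B"
  have D: "D \<in> carrier_mat n n" using B by (simp add: D_def)
  have "spectral_radius D \<in> norm ` spectrum D" by (rule spectral_radius_mem_max(1)[OF D n])
  then obtain a v where a: "spectral_radius D = norm a"
    and v: "v \<in> carrier_vec n" "v \<noteq> 0\<^sub>v n" "D *\<^sub>v v = a \<cdot>\<^sub>v v"
    using D by (auto simp: spectrum_def eigenvalue_def eigenvector_def)
  have "D *\<^sub>v v = complex_of_real (1 / s) \<cdot>\<^sub>v (B *\<^sub>v v)"
    by (rule eq_vecI)
       (use B D v(1) in \<open>auto simp: D_def mult_mat_vec_sum[of _ n] sum_distrib_left mult.assoc
          simp del: index_mult_mat_vec\<close>)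
  hence "a \<cdot>\<^sub>v v = complex_of_real (1 / s) \<cdot>\<^sub>v (B *\<^sub>v v)" using v(3) by simp
  hence "complex_of_real s \<cdot>\<^sub>v (a \<cdot>\<^sub>v v) =
      complex_of_real s \<cdot>\<^sub>v (complex_of_real (1 / s) \<cdot>\<^sub>v (B *\<^sub>v v))" by simp
  hence "B *\<^sub>v v = (of_real s * a) \<cdot>\<^sub>v v" using s0 by (simp add: smult_smult_assoc)
  hence "of_real s * a \<in> spectrum B"
    using v B by (auto simp: spectrum_def eigenvalue_def eigenvector_def)
  hence "norm (of_real s * a) \<le> spectral_radius B"
    by (intro spectral_radius_mem_max(2)[OF B n]) auto
  moreover have "norm (of_real s * a) = s * norm a" using s0 by (simp add: norm_mult)
  ultimately have "s * norm a < s * 1" using s by linarith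
  hence "spectral_radius D < 1" unfolding a using s0 by (simp only: mult_less_cancel_left_pos)
  from spectral_radius_jnf_norm_bound_less_1_upper_triangular[OF D this]
  obtain K where K: "\<And>k. norm_bound (D ^\<^sub>m k) K" by blast
  show thesis
  proof (rule that)
    fix k i j assume ij: "i < n" "j < n"
    have "norm ((D ^\<^sub>m k) $$ (i, j)) \<le> K" using K[of k] ij D unfolding norm_bound_def by simp
    also have "D ^\<^sub>m k = complex_of_real (1 / s) ^ k \<cdot>\<^sub>m (B ^\<^sub>m k)"
      unfolding D_def by (rule pow_smult_mat[OF B])
    also have "norm ((\<dots>) $$ (i, j)) = norm ((B ^\<^sub>m k) $$ (i, j)) / s ^ k"
      using ij B s0 by (simp add: norm_mult norm_power norm_divide power_divide)
    finally show "norm ((B ^\<^sub>m k) $$ (i, j)) \<le> K * s ^ k" using s0 by (simp add: field_simps)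
  qed
qed

text \<open>Scale \<open>y\<close> by the least \<open>t\<close> such that the moduli of a dominant eigenvector \<open>v\<close> are at most
  \<open>t y\<close>. Taking moduli in \<open>A v = a v\<close> gives the bound \<open>c t y\<close> for \<open>\<bar>a\<bar> \<bar>v\<bar>\<close>; at a coordinate where
  \<open>\<bar>v\<bar>\<close> touches \<open>t y\<close> this reads \<open>\<bar>a\<bar> \<le> c\<close>.\<close>

lemma Collatz_Wielandt_upper_bound:
  fixes A :: "real mat"
  assumes A: "A \<in> carrier_mat n n" and n: "n > 0" and y: "y \<in> carrier_vec n"
    and nonneg: "\<And>i j. i < n \<Longrightarrow> j < n \<Longrightarrow> A $$ (i, j) \<ge> 0"
    and pos: "\<And>i. i < n \<Longrightarrow> y $ i > 0"
    and le: "\<And>i. i < n \<Longrightarrow> (A *\<^sub>v y) $ i \<le> c * y $ i"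
  shows "real_spectral_radius A \<le> c"
proof -
  let ?B = "map_mat complex_of_real A"
  have B: "?B \<in> carrier_mat n n" using A by simp
  have "real_spectral_radius A \<in> norm ` spectrum ?B"
    unfolding real_spectral_radius_def by (rule spectral_radius_mem_max(1)[OF B n])
  then obtain a v where a: "real_spectral_radius A = norm a"
    and v: "v \<in> carrier_vec n" "v \<noteq> 0\<^sub>v n" "?B *\<^sub>v v = a \<cdot>\<^sub>v v"
    using B by (auto simp: spectrum_def eigenvalue_def eigenvector_def)
  let ?R = "(\<lambda>i. norm (v $ i) / y $ i) ` {..<n}"
  define t where "t = Max ?R"
  have fin: "finite ?R" "?R \<noteq> {}" using n by auto
  have t_ge: "norm (v $ i) \<le> t * y $ i" if "i < n" for i
  proof -
    have "norm (v $ i) / y $ i \<le> t" unfolding t_def using that by (intro Max_ge) auto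
    thus ?thesis using pos[OF that] by (simp add: field_simps)
  qed
  obtain i where i: "i < n" and "t = norm (v $ i) / y $ i"
    using Max_in[OF fin] unfolding t_def by auto
  hence ti: "norm (v $ i) = t * y $ i" using pos[OF i] by simp
  obtain k where k: "k < n" "v $ k \<noteq> 0" using v(1,2) by (metis eq_vecI carrier_vecD index_zero_vec)
  have "0 < t * y $ k" using t_ge[OF k(1)] k(2) by (smt (verit) zero_less_norm_iff)
  hence t0: "t > 0" using pos[OF k(1)] by (simp add: zero_less_mult_iff)
  have "norm a * (t * y $ i) = norm ((?B *\<^sub>v v) $ i)"
    using i v by (simp add: norm_mult ti)
  also have "\<dots> = norm (\<Sum>j<n. complex_of_real (A $$ (i, j)) * v $ j)"
    using mult_mat_vec_sum[OF B v(1) i] A i by simp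
  also have "\<dots> \<le> (\<Sum>j<n. A $$ (i, j) * (t * y $ j))"
    using nonneg[OF i] t_ge
    by (intro sum_norm_le) (auto simp: norm_mult intro!: mult_left_mono)
  also have "\<dots> = t * (A *\<^sub>v y) $ i"
    by (simp add: mult_mat_vec_sum[OF A y i] sum_distrib_left mult.left_commute)
  also have "\<dots> \<le> t * (c * y $ i)" using le[OF i] t0 by simp
  finally have "norm a * (t * y $ i) \<le> c * (t * y $ i)" by (simp add: mult.left_commute)
  moreover have "t * y $ i > 0" using t0 pos[OF i] by simp
  ultimately show ?thesis unfolding a by (rule mult_right_le_imp_le)
qed

section \<open>The orbit of a positive vector\<close>

locale positive_orbit =
  fixes A :: "real mat" and x :: "real vec" and n :: nat
  assumes dim_pos: "n > 0"
    and A: "A \<in> carrier_mat n n"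
    and x: "x \<in> carrier_vec n"
    and nonneg: "\<And>i j. i < n \<Longrightarrow> j < n \<Longrightarrow> A $$ (i, j) \<ge> 0"
    and diag_pos: "\<And>i. i < n \<Longrightarrow> A $$ (i, i) > 0"
    and x_pos: "\<And>i. i < n \<Longrightarrow> x $ i > 0"
begin

definition u :: "nat \<Rightarrow> real vec" where
  "u q = A ^\<^sub>m q *\<^sub>v x"

definition r :: "nat \<Rightarrow> nat \<Rightarrow> real" where
  "r i q = u (Suc q) $ i / u q $ i"

abbreviation C :: "nat \<Rightarrow> real" where
  "C \<equiv> max_ratio A x"

lemma u_carrier [simp]: "u q \<in> carrier_vec n"
  unfolding u_def using A x by (meson mult_mat_vec_carrier pow_carrier_mat)

lemma u_0 [simp]: "u 0 = x"
  unfolding u_def using A x by simp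

lemma u_add: "u (m + q) = A ^\<^sub>m m *\<^sub>v u q"
proof -
  have "A ^\<^sub>m (m + q) = A ^\<^sub>m m * A ^\<^sub>m q"
  proof (induction q)
    case 0
    then show ?case using A by simp
  next
    case (Suc q)
    then show ?case using A by (simp add: assoc_mult_mat[of _ n n _ n _ n])
  qed
  thus ?thesis unfolding u_def using A x by (simp add: assoc_mult_mat_vec[of _ n n _ n])
qed

lemma u_Suc: "u (Suc q) = A *\<^sub>v u q"
  using u_add[of 1 q] A by simp

lemma u_pos: "i < n \<Longrightarrow> u q $ i > 0"
proof (induction q arbitrary: i)
  case 0
  then show ?case using x_pos by simp
next
  case (Suc q)
  have "0 < A $$ (i, i) * u q $ i" using diag_pos Suc by simp
  also have "\<dots> \<le> (\<Sum>j<n. A $$ (i, j) * u q $ j)"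
    using Suc nonneg by (intro member_le_sum) (auto intro: less_imp_le mult_nonneg_nonneg)
  also have "\<dots> = u (Suc q) $ i" unfolding u_Suc using mult_mat_vec_sum[OF A _ Suc.prems] by simp
  finally show ?case .
qed

lemma max_ratio_eq: "C q = Max ((\<lambda>i. r i q) ` {..<n})"
  using A unfolding max_ratio_def r_def u_def by simp

lemma r_le_max_ratio: "i < n \<Longrightarrow> r i q \<le> C q"
  unfolding max_ratio_eq by (intro Max_ge) auto

lemma max_ratio_attained:
  obtains i where "i < n" "C q = r i q"
proof -
  have "C q \<in> (\<lambda>i. r i q) ` {..<n}"
    unfolding max_ratio_eq using dim_pos by (intro Max_in) auto
  thus thesis using that by auto
qed

lemma u_Suc_eq: "i < n \<Longrightarrow> u (Suc q) $ i = r i q * u q $ i"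
  using u_pos[of i q] by (simp add: r_def)

lemma u_Suc_le: "i < n \<Longrightarrow> u (Suc q) $ i \<le> C q * u q $ i"
  using u_pos[of i q] r_le_max_ratio[of i q] by (simp add: u_Suc_eq)

lemma r_pos: "i < n \<Longrightarrow> r i q > 0"
  using u_pos by (simp add: r_def)

lemma max_ratio_pos: "C q > 0"
  using r_pos max_ratio_attained by metis

text \<open>Applying \<open>A\<close> to the nonnegative vector \<open>c u q - u (Suc q)\<close> yields
  \<open>c u (Suc q) - u (Suc (Suc q))\<close>, and the \<open>i\<close>-th coordinate of the product is at least the
  contribution of the diagonal entry. Thus the gap below \<open>c\<close> can shrink by at most a fixed
  factor per step. Since the left-hand side is nonnegative, the gap also remains nonnegative,
  which is the monotonicity of \<open>C\<close>.\<close>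

lemma defect_decay:
  assumes i: "i < n" and c: "\<And>j. j < n \<Longrightarrow> r j q \<le> c"
  shows "A $$ (i, i) * (c - r i q) \<le> r i q * (c - r i (Suc q))"
proof -
  have "u (Suc (Suc q)) $ i = (\<Sum>j<n. A $$ (i, j) * u (Suc q) $ j)"
    unfolding u_Suc[of "Suc q"] using mult_mat_vec_sum[OF A _ i] by simp
  moreover have "u (Suc q) $ i = (\<Sum>j<n. A $$ (i, j) * u q $ j)"
    unfolding u_Suc[of q] using mult_mat_vec_sum[OF A _ i] by simp
  ultimately have "c * u (Suc q) $ i - u (Suc (Suc q)) $ i =
      (\<Sum>j<n. A $$ (i, j) * ((c - r j q) * u q $ j))"
    by (simp add: sum_distrib_left sum_subtractf u_Suc_eq algebra_simps)
  also have "\<dots> \<ge> A $$ (i, i) * ((c - r i q) * u q $ i)"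
    using i nonneg c u_pos
    by (intro member_le_sum) (auto intro!: mult_nonneg_nonneg intro: less_imp_le)
  finally have "(A $$ (i, i) * (c - r i q)) * u q $ i \<le> (r i q * (c - r i (Suc q))) * u q $ i"
    using i by (simp add: u_Suc_eq algebra_simps)
  thus ?thesis using u_pos[OF i] by simp
qed

lemma decseq_max_ratio: "decseq C"
proof (rule decseq_SucI)
  fix q
  obtain i where i: "i < n" "C (Suc q) = r i (Suc q)" by (rule max_ratio_attained)
  have "0 \<le> A $$ (i, i) * (C q - r i q)"
    using diag_pos[OF i(1)] r_le_max_ratio[OF i(1)] by simp
  also have "\<dots> \<le> r i q * (C q - r i (Suc q))"
    by (rule defect_decay[OF i(1) r_le_max_ratio])
  finally show "C (Suc q) \<le> C q" using r_pos[OF i(1), of q] i(2) by (simp add: zero_le_mult_iff)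
qed

lemma spectral_radius_le_max_ratio: "real_spectral_radius A \<le> C q"
  by (rule Collatz_Wielandt_upper_bound[OF A dim_pos u_carrier nonneg])
     (use u_pos u_Suc_le[unfolded u_Suc] in auto)

lemma u_add_le: "i < n \<Longrightarrow> u (m + q) $ i \<le> C 0 ^ m * u q $ i"
proof (induction m)
  case (Suc m)
  have "u (Suc (m + q)) $ i \<le> C (m + q) * u (m + q) $ i" by (rule u_Suc_le[OF Suc.prems])
  also have "\<dots> \<le> C 0 * (C 0 ^ m * u q $ i)"
    using Suc decseqD[OF decseq_max_ratio, of 0 "m + q"] max_ratio_pos[of 0] u_pos[OF Suc.prems, of "m + q"]
    by (intro mult_mono) auto
  finally show ?case by (simp add: mult.assoc)
qed simp

lemma power_nonneg: "i < n \<Longrightarrow> j < n \<Longrightarrow> (A ^\<^sub>m m) $$ (i, j) \<ge> 0"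
proof (induction m arbitrary: j)
  case (Suc m)
  have "(A ^\<^sub>m Suc m) $$ (i, j) = (\<Sum>k<n. (A ^\<^sub>m m) $$ (i, k) * A $$ (k, j))"
    using Suc.prems A by (auto simp: scalar_prod_def lessThan_atLeast0 intro!: sum.cong)
  also have "\<dots> \<ge> 0" using Suc nonneg by (intro sum_nonneg) auto
  finally show ?case .
qed (use A in auto)

lemma u_add_sum: "i < n \<Longrightarrow> u (m + q) $ i = (\<Sum>j<n. (A ^\<^sub>m m) $$ (i, j) * u q $ j)"
  unfolding u_add using A by (intro mult_mat_vec_sum) auto

text \<open>If \<open>m\<close> steps lead from \<open>j\<close> to \<open>i\<close>, then \<open>u (m + q) $ i\<close> is at least \<open>(A\<^sup>m)\<^sub>i\<^sub>j\<close> times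
  \<open>u q $ j\<close> and at most \<open>(C 0)\<^sup>m\<close> times \<open>u q $ i\<close>. The point is that \<open>M\<close> depends neither on \<open>q\<close>
  nor on \<open>m\<close>: one witness \<open>m\<close> for each of the finitely many pairs \<open>i\<close>, \<open>j\<close> is enough.\<close>

lemma reachable_comparable:
  obtains M where "M > 0" and
    "\<And>i j m q. i < n \<Longrightarrow> j < n \<Longrightarrow> (A ^\<^sub>m m) $$ (i, j) > 0 \<Longrightarrow> u q $ j \<le> M * u q $ i"
proof -
  have "\<exists>M. \<forall>m q. (A ^\<^sub>m m) $$ (i, j) > 0 \<longrightarrow> u q $ j \<le> M * u q $ i"
    if ij: "i < n" "j < n" for i j
  proof (cases "\<exists>m. (A ^\<^sub>m m) $$ (i, j) > 0")
    case True
    then obtain m where m: "(A ^\<^sub>m m) $$ (i, j) > 0" by blast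
    have "u q $ j \<le> C 0 ^ m / (A ^\<^sub>m m) $$ (i, j) * u q $ i" for q
    proof -
      have "(A ^\<^sub>m m) $$ (i, j) * u q $ j \<le> u (m + q) $ i"
        unfolding u_add_sum[OF ij(1)] using ij power_nonneg u_pos
        by (intro member_le_sum) (auto intro!: mult_nonneg_nonneg intro: less_imp_le)
      also have "\<dots> \<le> C 0 ^ m * u q $ i" by (rule u_add_le[OF ij(1)])
      finally show ?thesis using m by (simp add: field_simps)
    qed
    thus ?thesis by blast
  qed blast
  then obtain f where f: "\<And>i j m q. i < n \<Longrightarrow> j < n \<Longrightarrow> (A ^\<^sub>m m) $$ (i, j) > 0 \<Longrightarrow>
      u q $ j \<le> f i j * u q $ i" by metis
  have "bdd_above ((\<lambda>(i, j). f i j) ` ({..<n} \<times> {..<n}))" by (intro bdd_above_finite) auto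
  then obtain M where M: "\<And>i j. i < n \<Longrightarrow> j < n \<Longrightarrow> f i j \<le> M"
    unfolding bdd_above_def by fastforce
  show thesis
  proof (rule that[of "max M 1"])
    fix i j m q
    assume ij: "i < n" "j < n" and "(A ^\<^sub>m m) $$ (i, j) > 0"
    hence "u q $ j \<le> f i j * u q $ i" by (rule f)
    also have "\<dots> \<le> max M 1 * u q $ i"
      using M[OF ij] u_pos[OF ij(1), of q] by (intro mult_right_mono) auto
    finally show "u q $ j \<le> max M 1 * u q $ i" .
  qed simp
qed

text \<open>Bounding \<open>A\<^sup>m\<close> entrywise would only control \<open>u (m + q) $ i\<close> by the largest coordinate of
  \<open>u q\<close>, which may be far larger than the \<open>i\<close>-th one when \<open>A\<close> is reducible. The coordinates
  that actually enter the sum are comparable with the \<open>i\<close>-th.\<close>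

lemma uniform_growth:
  assumes s: "real_spectral_radius A < s"
  obtains L where "\<And>i m q. i < n \<Longrightarrow> u (m + q) $ i \<le> L * s ^ m * u q $ i"
proof -
  let ?B = "map_mat complex_of_real A"
  have B: "?B \<in> carrier_mat n n" using A by simp
  obtain K where K: "\<And>k i j. i < n \<Longrightarrow> j < n \<Longrightarrow> norm ((?B ^\<^sub>m k) $$ (i, j)) \<le> K * s ^ k"
    using power_entries_bound[OF B dim_pos s[unfolded real_spectral_radius_def]] by blast
  have A_le: "(A ^\<^sub>m m) $$ (i, j) \<le> K * s ^ m" if "i < n" "j < n" for i j m
  proof -
    have "?B ^\<^sub>m m = map_mat complex_of_real (A ^\<^sub>m m)"
      by (rule of_real_hom.mat_hom_pow[OF A, symmetric])
    hence "norm ((?B ^\<^sub>m m) $$ (i, j)) = (A ^\<^sub>m m) $$ (i, j)"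
      using that A power_nonneg[OF that] by simp
    thus ?thesis using K[OF that, of m] by simp
  qed
  obtain M where M: "M > 0" "\<And>i j m q. i < n \<Longrightarrow> j < n \<Longrightarrow> (A ^\<^sub>m m) $$ (i, j) > 0 \<Longrightarrow>
      u q $ j \<le> M * u q $ i"
    using reachable_comparable by blast
  show thesis
  proof (rule that)
    fix i m q assume i: "i < n"
    have "u (m + q) $ i \<le> (\<Sum>j<n. K * s ^ m * (M * u q $ i))"
      unfolding u_add_sum[OF i]
    proof (rule sum_mono)
      fix j assume "j \<in> {..<n}"
      hence j: "j < n" by simp
      have "(A ^\<^sub>m m) $$ (i, j) * u q $ j \<le> (A ^\<^sub>m m) $$ (i, j) * (M * u q $ i)"
        using M(2)[OF i j, of m q] power_nonneg[OF i j, of m]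
        by (cases "(A ^\<^sub>m m) $$ (i, j) = 0") (auto intro!: mult_left_mono)
      also have "\<dots> \<le> K * s ^ m * (M * u q $ i)"
        using A_le[OF i j] M(1) u_pos[OF i, of q] by (intro mult_right_mono) auto
      finally show "(A ^\<^sub>m m) $$ (i, j) * u q $ j \<le> K * s ^ m * (M * u q $ i)" .
    qed
    also have "\<dots> = (of_nat n * K * M) * s ^ m * u q $ i" by simp
    finally show "u (m + q) $ i \<le> (of_nat n * K * M) * s ^ m * u q $ i" .
  qed
qed

section \<open>Persistence of large ratios\<close>

text \<open>Choose \<open>q\<close> so late that \<open>C q\<close> exceeds its limit by a tiny amount, and \<open>i\<close> as the
  coordinate that realises the maximum at the end \<open>q + m\<close> of the window. There the gap between
  \<open>C q\<close> and the ratio is tiny, and going back through the window multiplies it by at most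
  \<open>d\<close> per step.\<close>

lemma large_ratio_window:
  assumes lim: "C \<longlonglongrightarrow> c" and s: "s < c"
  obtains q i where "i < n" "\<And>k. k \<le> m \<Longrightarrow> s \<le> r i (q + k)"
proof -
  define a where "a = Min ((\<lambda>i. A $$ (i, i)) ` {..<n})"
  have a_le: "a \<le> A $$ (i, i)" if "i < n" for i
    unfolding a_def using that by (intro Min_le) auto
  have a0: "a > 0"
    unfolding a_def using dim_pos diag_pos by (subst Min_gr_iff) auto
  \<comment> \<open>The gap loses at most the factor \<open>a / C 0\<close> per step forward, so it gains at most \<open>C 0 / a\<close>
    per step back; the maximum with 1 makes the powers of \<open>d\<close> monotone without comparing
    \<open>a\<close> with \<open>C 0\<close>.\<close>
  define d where "d = max 1 (C 0 / a)"
  have d1: "d \<ge> 1" by (simp add: d_def)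
  have step: "C q - r i t \<le> d * (C q - r i (Suc t))" if i: "i < n" and t: "q \<le> t" for i q t
  proof -
    have le: "r j t \<le> C q"
      if "q \<le> t" "j < n" for j t
      using r_le_max_ratio[of j t] decseqD[OF decseq_max_ratio, of q t] that by simp
    have "a * (C q - r i t) \<le> A $$ (i, i) * (C q - r i t)"
      using a_le[OF i] le[OF t i] by (intro mult_right_mono) auto
    also have "\<dots> \<le> r i t * (C q - r i (Suc t))" using le[OF t] by (intro defect_decay[OF i])
    also have "\<dots> \<le> C 0 * (C q - r i (Suc t))"
      using le[of "Suc t" i] i t r_le_max_ratio[OF i, of t] decseqD[OF decseq_max_ratio, of 0 t]
      by (intro mult_right_mono) auto
    finally have "C q - r i t \<le> C 0 / a * (C q - r i (Suc t))" using a0 by (simp add: field_simps)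
    also have "\<dots> \<le> d * (C q - r i (Suc t))"
      using le[of "Suc t" i] i t by (intro mult_right_mono) (auto simp: d_def)
    finally show ?thesis .
  qed
  have "(\<lambda>q. d ^ m * (C q - c)) \<longlonglongrightarrow> d ^ m * (c - c)"
    by (intro tendsto_intros lim)
  hence "eventually (\<lambda>q. d ^ m * (C q - c) < c - s) sequentially"
    using s by (intro order_tendstoD) auto
  then obtain q where q: "d ^ m * (C q - c) < c - s" by (auto dest: eventually_happens)
  have c_le: "c \<le> C t" for t by (rule decseq_ge[OF decseq_max_ratio lim])
  obtain i where i: "i < n" "C (q + m) = r i (q + m)" by (rule max_ratio_attained)
  have propagate: "C q - r i (q + m - k) \<le> d ^ k * (C q - c)" if "k \<le> m" for k
    using that
  proof (induction k)
    case 0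
    then show ?case using i(2) c_le[of "q + m"] by simp
  next
    case (Suc k)
    have "C q - r i (q + m - Suc k) \<le> d * (C q - r i (Suc (q + m - Suc k)))"
      using Suc.prems by (intro step i) auto
    also have "Suc (q + m - Suc k) = q + m - k" using Suc.prems by simp
    also have "d * (C q - r i (q + m - k)) \<le> d * (d ^ k * (C q - c))"
      using Suc d1 by (intro mult_left_mono) auto
    finally show ?case by simp
  qed
  show thesis
  proof (rule that[OF i(1)])
    fix k assume k: "k \<le> m"
    have "C q - r i (q + k) \<le> d ^ (m - k) * (C q - c)" using propagate[of "m - k"] k by simp
    also have "\<dots> \<le> d ^ m * (C q - c)"
      using d1 c_le by (intro mult_right_mono power_increasing) auto
    finally show "s \<le> r i (q + k)" using q c_le[of q] by linarith
  qed
qed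

lemma limit_le_spectral_radius:
  assumes lim: "C \<longlonglongrightarrow> c"
  shows "c \<le> real_spectral_radius A"
proof (rule ccontr)
  assume "\<not> ?thesis"
  then obtain s where s: "real_spectral_radius A < s" "s < c" using dense not_le by metis
  \<comment> \<open>Two rates strictly between: \<open>s\<close> for the growth bound, \<open>t\<close> for the window.\<close>
  obtain t where t: "s < t" "t < c" using dense[OF s(2)] by blast
  have s0: "s > 0"
    using spectral_radius_nonneg[of "map_mat complex_of_real A" n] A dim_pos s(1)
    by (simp add: real_spectral_radius_def)
  obtain L where L: "\<And>i m q. i < n \<Longrightarrow> u (m + q) $ i \<le> L * s ^ m * u q $ i"
    using uniform_growth[OF s(1)] by blast
  have "(t / s) ^ m \<le> L" for m
  proof -
    obtain q i where i: "i < n" and win: "\<And>k. k \<le> m \<Longrightarrow> t \<le> r i (q + k)"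
      using large_ratio_window[OF lim t(2), where m = m] by blast
    have "t ^ k * u q $ i \<le> u (k + q) $ i" if "k \<le> m" for k
      using that
    proof (induction k)
      case (Suc k)
      have "t ^ Suc k * u q $ i = t * (t ^ k * u q $ i)" by simp
      also have "\<dots> \<le> r i (q + k) * u (k + q) $ i"
        using Suc win[of k] s0 t(1) u_pos[OF i, of q] r_pos[OF i]
        by (intro mult_mono) (auto intro: less_imp_le)
      finally show ?case using u_Suc_eq[OF i, of "k + q"] by (simp add: add.commute)
    qed simp
    from order_trans[OF this[OF order_refl] L[OF i]] have "t ^ m \<le> L * s ^ m"
      using u_pos[OF i, of q] by simp
    thus ?thesis using s0 by (simp add: power_divide field_simps)
  qed
  moreover obtain m where "L < (t / s) ^ m"
    using real_arch_pow[of "t / s" L] s0 t(1) by auto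
  ultimately show False by (meson not_le)
qed

lemma max_ratio_tendsto_INF: "C \<longlonglongrightarrow> (INF q. C q)"
  using decseq_max_ratio max_ratio_pos
  by (intro LIMSEQ_decseq_INF bdd_belowI2[where m = 0]) (auto intro: less_imp_le)

lemma spectral_radius_eq_INF: "real_spectral_radius A = (INF q. C q)"
  using limit_le_spectral_radius[OF max_ratio_tendsto_INF] spectral_radius_le_max_ratio
  by (intro antisym cINF_greatest) auto

end

theorem proposition3p3:
  fixes A :: "real mat" and x :: "real vec" and n :: nat
  assumes "n > 0"
    and "A \<in> carrier_mat n n"
    and "x \<in> carrier_vec n"
    and "\<And>i j. i < n \<Longrightarrow> j < n \<Longrightarrow> A $$ (i, j) \<ge> 0"
    and "\<And>i. i < n \<Longrightarrow> A $$ (i, i) > 0"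
    and "\<And>i. i < n \<Longrightarrow> x $ i > 0"
  shows "decseq (\<lambda>q. max_ratio A x q)
    \<and> (\<lambda>q. max_ratio A x q) \<longlonglongrightarrow> real_spectral_radius A
    \<and> real_spectral_radius A = (INF q. max_ratio A x q)"
proof -
  interpret positive_orbit A x n using assms by unfold_locales auto
  show ?thesis
    using decseq_max_ratio max_ratio_tendsto_INF by (simp add: spectral_radius_eq_INF)
qed

end
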